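(* For every integer $n\ge 3$, all zeros of the polynomial $P_{n}(x)$ are simple and lie in the segment $[-1,1]$.
   Context: For integers $n,k\ge 0$ let $$f(n,k,2,2)=\sum_{i=0}^n(-1)^i\binom{n}{i}\binom{2n+2-2i}{n+k},$$ where $\binom{a}{b}=0$ for $b>a\ge 0$, and put $f(n,k,2,2)=0$ if $n<0$. For $n\ge 2$ and $0\le k\le n$ let $c(n,k,2,2)=(-1)^{\frac{n-k}{2}}f\left(\frac{n+k-4}{2},\frac{n-k}{2},2,2\right)$ if $n$ and $k$ have the same parity, and $c(n,k,2,2)=0$ otherwise. The polynomial $P_n(x)$ is $P_n(x)=P_{n,2,2}(x)=\sum_{k=0}^n c(n,k,2,2)x^k$, $n\ge 2$. For example $P_2(x)=x^2$, $P_3(x)=2x^3-2x$, $P_4(x)=4x^4-5x^2+1$. "All zeros" means all complex zeros. *)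

theory Defs
  imports "HOL-Analysis.Line_Segment" "HOL-Computational_Algebra.Polynomial"
begin

text \<open>The numbers \<open>f(n,k,2,2)\<close>. The first argument is an integer because the definition of the
  coefficients below uses \<open>f(-1,1,2,2) = 0\<close>. The subtraction on \<open>nat\<close> never truncates, as
  \<open>i \<le> n\<close>.\<close>

definition f22 :: "int \<Rightarrow> nat \<Rightarrow> int" where
  "f22 m k =
     (if m < 0 then 0
      else (let n = nat m in
        \<Sum>i=0..n. (-1) ^ i * int (n choose i) * int ((2 * n + 2 - 2 * i) choose (n + k))))"

text \<open>Only meant for \<open>2 \<le> n\<close> and \<open>k \<le> n\<close>; both divisions are exact in the first branch.\<close>

definition c22 :: "nat \<Rightarrow> nat \<Rightarrow> int" where
  "c22 n k =
     (if even n \<longleftrightarrow> even k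
      then (-1) ^ ((n - k) div 2) * f22 ((int n + int k - 4) div 2) ((n - k) div 2)
      else 0)"

definition P :: "nat \<Rightarrow> complex poly" where
  "P n = (\<Sum>k=0..n. monom (of_int (c22 n k)) k)"

end

theory Submission
  imports Defs "HOL-Analysis.Complex_Transcendental"
begin

text \<open>
  The key is the identity \<open>P\<^sub>n(cos t) = - sin t * sin ((n - 1) t)\<close> for \<open>n \<ge> 3\<close>; equivalently,
  \<open>P\<^sub>n = (x\<^sup>2 - 1) U\<^sub>n\<^sub>-\<^sub>2\<close> with \<open>U\<close> the Chebyshev polynomials of the second kind. It exhibits the
  \<open>n\<close> distinct real zeros \<open>cos (j \<pi> / (n - 1))\<close>, \<open>0 \<le> j < n\<close>, in the segment. As the degree of
  \<open>P\<^sub>n\<close> is at most \<open>n\<close>, there is no room for another zero or for a multiplicity above one.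

  The identity comes from the three-term recurrence \<open>P\<^sub>n\<^sub>+\<^sub>2 = 2 x P\<^sub>n\<^sub>+\<^sub>1 - P\<^sub>n\<close>, which
  \<open>- sin t * sin ((n - 1) t)\<close> satisfies as well. To get the recurrence, the alternating sum
  defining \<open>f(m,k,2,2)\<close> is read as the binomial expansion of
  \<open>(1 + t)\<^sup>2 ((1 + t)\<^sup>2 - 1)\<^sup>m = t\<^sup>m (1 + t)\<^sup>2 (2 + t)\<^sup>m\<close>; hence \<open>f(m,k,2,2)\<close> is the coefficient of \<open>t\<^sup>k\<close>
  in \<open>(1 + t)\<^sup>2 (2 + t)\<^sup>m\<close> (lemma \<open>f22_eq_coeff\<close>), and multiplication by \<open>2 + t\<close> gives a
  Pascal-like rule for these numbers, whose two terms turn into the two terms of the recurrence.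
  The recurrence fails for \<open>n = 2\<close>, where the convention \<open>f(-1,1,2,2) = 0\<close> interferes, so the
  induction starts from \<open>P\<^sub>3\<close> and \<open>P\<^sub>4\<close>.
\<close>

section \<open>The numbers \<open>f(m,k,2,2)\<close> as polynomial coefficients\<close>

definition f_poly :: "nat \<Rightarrow> int poly" where
  "f_poly m = [:1, 1:] ^ 2 * [:2, 1:] ^ m"

lemma coeff_one_plus_x_power: "coeff ([:1, 1:] ^ N :: int poly) r = int (N choose r)"
proof (cases "r \<le> N")
  case True
  then show ?thesis by (simp add: coeff_linear_poly_power)
next
  case False
  have "degree ([:1, 1:] ^ N :: int poly) \<le> N"
    using degree_power_le[of "[:1, 1:] :: int poly" N] by simp
  then show ?thesis using False by (simp add: coeff_eq_0)
qed

lemma f22_eq_coeff: "f22 (int m) k = coeff (f_poly m) k"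
proof -
  let ?q = "[:1, 1:] :: int poly"
  have sq: "monom 1 1 * [:2, 1:] = - 1 + ?q ^ 2"
    by (simp add: power2_eq_square monom_altdef one_pCons)
  have "monom 1 m * f_poly m = ?q ^ 2 * (monom 1 1 * [:2, 1:]) ^ m"
    by (simp only: f_poly_def power_mult_distrib monom_power power_one mult_1 mult_ac)
  also have "\<dots> = ?q ^ 2 * (- 1 + ?q ^ 2) ^ m"
    by (simp only: sq)
  also have "\<dots> = (\<Sum>i\<le>m. ?q ^ 2 * (of_nat (m choose i) * (- 1) ^ i * (?q ^ 2) ^ (m - i)))"
    by (simp only: binomial_ring sum_distrib_left)
  also have "\<dots> = (\<Sum>i\<le>m. smult ((- 1) ^ i * int (m choose i)) (?q ^ (2 * m + 2 - 2 * i)))"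
  proof (rule sum.cong)
    fix i assume "i \<in> {..m}"
    then have "2 * m + 2 - 2 * i = 2 + 2 * (m - i)" by auto
    then have "?q ^ (2 * m + 2 - 2 * i) = ?q ^ 2 * (?q ^ 2) ^ (m - i)"
      by (simp only: power_add power_mult)
    moreover have "(of_nat (m choose i) * (- 1) ^ i :: int poly)
        = [:(- 1) ^ i * int (m choose i):]"
      by (cases "even i") (simp_all add: of_nat_poly)
    ultimately show "?q ^ 2 * (of_nat (m choose i) * (- 1) ^ i * (?q ^ 2) ^ (m - i))
        = smult ((- 1) ^ i * int (m choose i)) (?q ^ (2 * m + 2 - 2 * i))"
      by (simp add: mult.left_commute)
  qed simp
  finally have "coeff (monom 1 m * f_poly m) (m + k)
      = (\<Sum>i\<le>m. (- 1) ^ i * int (m choose i) * int ((2 * m + 2 - 2 * i) choose (m + k)))"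
    by (simp add: coeff_sum coeff_one_plus_x_power)
  then show ?thesis
    by (simp add: f22_def coeff_monom_mult atLeast0AtMost)
qed

lemma coeff_f_poly_Suc_0: "coeff (f_poly (Suc m)) 0 = 2 * coeff (f_poly m) 0"
  by (simp add: f_poly_def coeff_mult_0)

text \<open>This is the Pascal-like rule given by the factor \<open>2 + t\<close>.\<close>

lemma coeff_f_poly_Suc_Suc:
  "coeff (f_poly (Suc m)) (Suc k) = 2 * coeff (f_poly m) (Suc k) + coeff (f_poly m) k"
proof -
  have "f_poly (Suc m) = [:2, 1:] * f_poly m"
    by (simp only: f_poly_def power_Suc mult_ac)
  then show ?thesis by simp
qed

lemma coeff_f_poly_eq_0:
  assumes "m + 2 < k"
  shows "coeff (f_poly m) k = 0"
proof -
  have "degree ([:1, 1:] ^ 2 :: int poly) \<le> 2" "degree ([:2, 1:] ^ m :: int poly) \<le> m"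
    using degree_power_le[of "[:1, 1:] :: int poly" 2] degree_power_le[of "[:2, 1:] :: int poly" m]
    by simp_all
  then have "degree (f_poly m) \<le> m + 2"
    unfolding f_poly_def by (intro order_trans[OF degree_mult_le]) simp
  then show ?thesis using assms by (simp add: coeff_eq_0)
qed

section \<open>The three-term recurrence\<close>

lemma coeff_P: "coeff (P n) k = (if k \<le> n then of_int (c22 n k) else 0)"
  by (simp add: P_def coeff_sum)

text \<open>The parametrisation of a coefficient by \<open>m\<close> and \<open>j\<close> instead of \<open>n = m + j + 2\<close> and
  \<open>k = m + 2 - j\<close> says which coefficients avoid the convention \<open>f(-1,k,2,2) = 0\<close>, and it
  removes the divisions.\<close>

lemma coeff_P_eq_coeff_f_poly:
  assumes "k + j = m + 2"
  shows "coeff (P (m + j + 2)) k = of_int ((-1) ^ j * coeff (f_poly m) j)"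
proof -
  have n: "m + j + 2 = k + 2 * j" using assms by simp
  have "(int (m + j + 2) + int k - 4) div 2 = int m" using assms by linarith
  moreover have "(m + j + 2 - k) div 2 = j" using n by simp
  moreover have "even (m + j + 2) \<longleftrightarrow> even k" unfolding n by simp
  moreover have "k \<le> m + j + 2" using n by simp
  ultimately show ?thesis by (simp add: coeff_P c22_def f22_eq_coeff del: of_nat_add)
qed

lemma coeff_P_odd: "even n \<noteq> even k \<Longrightarrow> coeff (P n) k = 0"
  by (simp add: coeff_P c22_def)

text \<open>The coefficient of \<open>x\<^sup>k\<close> is \<open>\<plusminus>f(m+1,j)\<close> on the left, with \<open>k + 2 j = n + 2\<close>; in \<open>x P\<^sub>n\<^sub>+\<^sub>1\<close> it is
  \<open>\<plusminus>f(m,j)\<close> with the same sign, and in \<open>P\<^sub>n\<close> it is \<open>\<plusminus>f(m,j-1)\<close> with the opposite sign. So the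
  Pascal-like rule is the claim. At \<open>k = 0\<close>, where \<open>x P\<^sub>n\<^sub>+\<^sub>1\<close> contributes nothing, \<open>j = m + 3\<close> exceeds
  the degree of \<open>(1 + t)\<^sup>2 (2 + t)\<^sup>m\<close>.\<close>

lemma P_recurrence:
  assumes "n \<ge> 3"
  shows "P (n + 2) = [:0, 2:] * P (n + 1) - P n"
proof (rule poly_eqI)
  fix k
  have shift: "coeff ([:0, 2:] * P (n + 1)) k = (case k of 0 \<Rightarrow> 0 | Suc l \<Rightarrow> 2 * coeff (P (n + 1)) l)"
    by (simp split: nat.split)
  have "coeff (P (n + 2)) k = coeff ([:0, 2:] * P (n + 1)) k - coeff (P n) k"
  proof (cases "k \<le> n + 2 \<and> (even (n + 2) \<longleftrightarrow> even k)")
    case False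
    then consider "k > n + 2" | "even n \<noteq> even k" by fastforce
    then show ?thesis
    proof cases
      case 1
      then show ?thesis unfolding shift by (simp add: coeff_P split: nat.split)
    next
      case 2
      then show ?thesis unfolding shift by (auto simp: coeff_P_odd split: nat.split)
    qed
  next
    case True
    then have "even (n + 2 - k)" by auto
    then obtain j where "n + 2 - k = 2 * j" by (rule evenE)
    then have j: "k + 2 * j = n + 2" using conjunct1[OF True] by arith
    \<comment> \<open>The bound on \<open>n\<close> keeps the first argument \<open>n - j\<close> of \<open>f\<close> positive, so that the rule for
      \<open>f(m+1,j)\<close> applies.\<close>
    define m where "m = n - j - 1"
    have n: "n + 2 = Suc m + j + 2" and k: "k + j = Suc m + 2"
      using j assms by (auto simp: m_def)
    have lhs: "coeff (P (n + 2)) k = of_int ((-1) ^ j * coeff (f_poly (Suc m)) j)"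
      unfolding n by (rule coeff_P_eq_coeff_f_poly[OF k])
    have mid: "coeff ([:0, 2:] * P (n + 1)) k = of_int (2 * (-1) ^ j * coeff (f_poly m) j)"
    proof (cases k)
      case 0
      then show ?thesis using k by (simp add: coeff_f_poly_eq_0)
    next
      case (Suc l)
      have n': "n + 1 = m + j + 2" and "l + j = m + 2" using n k Suc by auto
      then have "coeff (P (n + 1)) l = of_int ((-1) ^ j * coeff (f_poly m) j)"
        unfolding n' by (intro coeff_P_eq_coeff_f_poly)
      then show ?thesis unfolding shift Suc by simp
    qed
    show ?thesis
    proof (cases j)
      case 0
      then have "coeff (P n) k = 0" using j by (simp add: coeff_P)
      then show ?thesis unfolding lhs mid using 0 by (simp add: coeff_f_poly_Suc_0)
    next
      case (Suc i)
      have n'': "n = m + i + 2" and "k + i = m + 2" using n k Suc by auto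
      then have "coeff (P n) k = of_int ((-1) ^ i * coeff (f_poly m) i)"
        by (metis coeff_P_eq_coeff_f_poly)
      then show ?thesis
        unfolding lhs mid Suc by (simp add: coeff_f_poly_Suc_Suc algebra_simps)
    qed
  qed
  then show "coeff (P (n + 2)) k = coeff ([:0, 2:] * P (n + 1) - P n) k" by simp
qed

section \<open>The trigonometric form and the zeros\<close>

lemma poly_P_3: "poly (P 3) z = 2 * z ^ 3 - 2 * z"
proof -
  have set: "{0..3::nat} = {0,1,2,3}" by auto
  have "c22 3 0 = 0" "c22 3 1 = -2" "c22 3 2 = 0" "c22 3 3 = 2"
    by code_simp+
  then show ?thesis unfolding P_def set by (simp add: poly_monom)
qed

lemma poly_P_4: "poly (P 4) z = 4 * z ^ 4 - 5 * z ^ 2 + 1"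
proof -
  have set: "{0..4::nat} = {0,1,2,3,4}" by auto
  have "c22 4 0 = 1" "c22 4 1 = 0" "c22 4 2 = -5" "c22 4 3 = 0" "c22 4 4 = 4"
    by code_simp+
  then show ?thesis unfolding P_def set by (simp add: poly_monom)
qed

text \<open>The index is shifted to start the induction at the first \<open>n\<close> for which the identity holds.\<close>

lemma poly_P_cos:
  fixes t :: real
  shows "poly (P (n + 3)) (of_real (cos t)) = of_real (- sin t * sin (real (n + 2) * t))"
proof (induction n rule: less_induct)
  case (less n)
  consider "n = 0" | "n = 1" | m where "n = m + 2"
    by (metis One_nat_def add_2_eq_Suc' not0_implies_Suc)
  then show ?case
  proof cases
    case 1
    have "2 * cos t ^ 3 - 2 * cos t = - 2 * cos t * sin t ^ 2"
      unfolding sin_squared_eq by (simp add: algebra_simps power3_eq_cube power2_eq_square)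
    then have "2 * cos t ^ 3 - 2 * cos t = - sin t * sin (2 * t)"
      by (simp add: sin_double power2_eq_square)
    then have "of_real (2 * cos t ^ 3 - 2 * cos t) = (of_real (- sin t * sin (2 * t)) :: complex)"
      by (rule arg_cong)
    then show ?thesis using 1 by (simp add: poly_P_3)
  next
    case 2
    have "sin (3 * t) = sin (2 * t + t)" by simp
    also have "\<dots> = sin t * (4 * cos t ^ 2 - 1)"
      unfolding sin_add sin_double cos_double_cos by (simp add: algebra_simps power2_eq_square)
    finally have "- sin t * sin (3 * t) = - (sin t ^ 2) * (4 * cos t ^ 2 - 1)"
      by (simp add: power2_eq_square)
    moreover have "4 * cos t ^ 4 - 5 * cos t ^ 2 + 1 = - (sin t ^ 2) * (4 * cos t ^ 2 - 1)"
      unfolding sin_squared_eq by (simp add: algebra_simps power2_eq_square power4_eq_xxxx)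
    ultimately have "4 * cos t ^ 4 - 5 * cos t ^ 2 + 1 = - sin t * sin (3 * t)"
      by (simp only:)
    then have "of_real (4 * cos t ^ 4 - 5 * cos t ^ 2 + 1)
        = (of_real (- sin t * sin (3 * t)) :: complex)"
      by (rule arg_cong)
    then show ?thesis using 2 by (simp add: poly_P_4)
  next
    case (3 m)
    define a where "a = real (m + 3) * t"
    have args: "real (m + 2) * t = a - t" "real (m + 4) * t = a + t"
      by (simp_all add: a_def algebra_simps)
    have IH: "poly (P (m + 3)) (of_real (cos t)) = of_real (- sin t * sin (a - t))"
      "poly (P (m + 3 + 1)) (of_real (cos t)) = of_real (- sin t * sin a)"
      using less.IH[of m] less.IH[of "m + 1"] 3 unfolding args(1)
      by (simp_all add: a_def add_ac)
    have "2 * cos t * (- sin t * sin a) + sin t * sin (a - t) = - sin t * sin (a + t)"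
      by (simp add: sin_add sin_diff algebra_simps)
    then have "of_real (2 * cos t * (- sin t * sin a) + sin t * sin (a - t))
        = (of_real (- sin t * sin (a + t)) :: complex)"
      by (rule arg_cong)
    moreover have "P (m + 3 + 2) = [:0, 2:] * P (m + 3 + 1) - P (m + 3)"
      by (rule P_recurrence) simp
    then have "poly (P (m + 3 + 2)) (of_real (cos t))
        = of_real (2 * cos t * (- sin t * sin a) + sin t * sin (a - t))"
      by (simp only: poly_diff poly_mult IH) simp
    ultimately have "poly (P (m + 3 + 2)) (of_real (cos t)) = of_real (- sin t * sin (a + t))"
      by simp
    then show ?thesis using 3 by (simp only: args(2)[symmetric]) (simp add: add_ac)
  qed
qed

text \<open>The orders of all roots add up to at most the degree, and each of them is at least \<open>1\<close>. So
  a set of known roots as large as the degree already takes up the whole sum.\<close>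

lemma roots_exhausted_imp_simple:
  fixes p :: "'a :: idom poly"
  assumes "p \<noteq> 0" "finite A" "degree p \<le> card A" "\<And>a. a \<in> A \<Longrightarrow> poly p a = 0" "poly p z = 0"
  shows "z \<in> A \<and> order z p = 1"
proof -
  let ?R = "{x. poly p x = 0}"
  have fin: "finite ?R" using assms(1) by (rule poly_roots_finite)
  have sub: "A \<subseteq> ?R" using assms(4) by auto
  have pos: "order x p \<ge> 1" if "x \<in> ?R" for x
    using that assms(1) order_root[of p x] by (simp add: Suc_le_eq)
  have "sum (\<lambda>x. order x p) ?R \<le> card A"
    using sum_order_le_degree[OF assms(1)] assms(3) by linarith
  moreover have "card A \<le> card ?R" using fin sub by (rule card_mono)
  moreover have "sum (\<lambda>x. order x p) (?R - {z}) \<ge> card (?R - {z})"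
    using sum_mono[of "?R - {z}" "\<lambda>_. 1" "\<lambda>x. order x p"] pos by simp
  moreover have "sum (\<lambda>x. order x p) ?R = order z p + sum (\<lambda>x. order x p) (?R - {z})"
    using fin assms(5) by (intro sum.remove) auto
  moreover have "card ?R = Suc (card (?R - {z}))"
    using fin assms(5) by (intro card.remove) auto
  moreover have "order z p \<ge> 1" using pos assms(5) by simp
  ultimately have "order z p = 1" "card A = card ?R" by linarith+
  moreover have "A = ?R" using card_subset_eq[OF fin sub] \<open>card A = card ?R\<close> .
  ultimately show ?thesis using assms(5) by blast
qed

theorem theorem2p3:
  fixes n :: nat
  assumes "n \<ge> 3"
  shows "\<forall>z::complex. poly (P n) z = 0 \<longrightarrow> order z (P n) = 1 \<and> z \<in> closed_segment (-1) 1"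
proof (intro allI impI)
  fix z :: complex
  assume z: "poly (P n) z = 0"
  define t where "t = (\<lambda>j. real j * pi / real (n - 1))"
  define A where "A = (\<lambda>j. of_real (cos (t j)) :: complex) ` {..<n}"
  obtain m where m: "n = m + 3" using assms by (metis le_add_diff_inverse2)
  have cos_form: "poly (P n) (of_real (cos s)) = of_real (- sin s * sin (real (n - 1) * s))" for s
    using poly_P_cos[of m s] m by (simp add: numeral_eq_Suc)
  have "inj_on (\<lambda>j. of_real (cos (t j)) :: complex) {..<n}"
  proof (rule inj_onI)
    fix i j
    assume ij: "i \<in> {..<n}" "j \<in> {..<n}"
      and "of_real (cos (t i)) = (of_real (cos (t j)) :: complex)"
    then have cos_eq: "cos (t i) = cos (t j)" by (simp only: of_real_eq_iff)
    have bounds: "0 \<le> t l \<and> t l \<le> pi" if "l \<in> {..<n}" for l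
    proof -
      have "real l \<le> real (n - 1)" using that by auto
      then have "real l * pi \<le> real (n - 1) * pi" by (intro mult_right_mono) auto
      moreover have "real (n - 1) > 0" using assms by simp
      ultimately show ?thesis by (simp add: t_def pos_divide_le_eq del: of_nat_diff)
    qed
    have "t i = t j"
      by (rule cos_inj_pi) (use bounds ij cos_eq in blast)+
    then show "i = j" using assms by (simp add: t_def)
  qed
  then have card: "card A = n" by (simp add: A_def card_image)
  have root: "poly (P n) a = 0" if a_A: "a \<in> A" for a
  proof -
    obtain j where a: "a = of_real (cos (t j))" using a_A by (auto simp: A_def)
    have "real (n - 1) * t j = real j * pi" using assms by (simp add: t_def)
    then have "sin (real (n - 1) * t j) = 0" by (simp only: sin_npi)
    then show ?thesis unfolding a cos_form by simp
  qed
  \<comment> \<open>For \<open>s = \<pi> / (2 (n - 1))\<close> the second sine is \<open>1\<close>, so \<open>P\<^sub>n\<close> does not vanish identically.\<close>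
  have nz: "P n \<noteq> 0"
  proof
    assume "P n = 0"
    define s where "s = pi / (2 * real (n - 1))"
    have "real (n - 1) * s = pi / 2" using assms by (simp add: s_def del: of_nat_diff)
    then have "sin (real (n - 1) * s) = 1" by (simp only: sin_pi_half)
    then have "sin s = 0" using cos_form[of s] \<open>P n = 0\<close> by simp
    moreover have "s > 0" using assms by (simp add: s_def)
    moreover have "s < pi" using assms by (simp add: s_def field_simps)
    ultimately show False using sin_gt_zero[of s] by simp
  qed
  have "degree (P n) \<le> n" by (rule degree_le) (simp add: coeff_P)
  then have conc: "z \<in> A \<and> order z (P n) = 1"
    using nz card root z by (intro roots_exhausted_imp_simple) (auto simp: A_def)
  then obtain j where zj: "z = of_real (cos (t j))" by (auto simp: A_def)
  have "cos (t j) \<in> closed_segment (-1) 1"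
    by (simp add: closed_segment_eq_real_ivl)
  then have "z \<in> closed_segment (of_real (-1)) (of_real 1)"
    unfolding zj closed_segment_of_real by (rule imageI)
  then show "order z (P n) = 1 \<and> z \<in> closed_segment (-1) 1" using conc by simp
qed

end
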